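(* Let $(\Bbbk^{\mathbb{Z}_2}{}^\tau\#_{\sigma}\Bbbk F,R)$ be a coquasitriangular Hopf algebra, where $F$ is an abelian group and $F\neq S$. Then one of the following two cases must hold: (1) $R(p_1\#f,p_g\#f')=R(p_g\#f,p_1\#f')=R(p_g\#f,p_g\#f')=0$ for all $f,f'\in F$. (2) $R(p_x\#f,p_y\#f')$ ($x,y\in\mathbb{Z}_2$, $f,f'\in F$) vanishes except in the following instances: (i) $R(p_1\#f,p_1\#f')\neq0$ only when $f,f'\in S$; (ii) $R(p_1\#f,p_g\#f')\neq0$ only when $f\in T$, $f'\in S$; (iii) $R(p_g\#f,p_1\#f')\neq0$ only when $f\in S$, $f'\in T$; (iv) $R(p_g\#f,p_g\#f')\neq0$ only when $f,f'\in T$.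
   Context: $\Bbbk$ is an algebraically closed field of characteristic zero, $G=\mathbb{Z}_2=\langle g\mid g^2=1\rangle$ and $F$ is a group. $(F,G,\triangleleft,\triangleright)$ is a matched pair of groups: $\triangleleft:G\times F\to G$ is a right action of $F$ on the set $G$ and $\triangleright:G\times F\to F$ is a left action of $G$ on the set $F$, such that $a\triangleright(ff')=(a\triangleright f)((a\triangleleft f)\triangleright f')$ and $(ab)\triangleleft f=(a\triangleleft(b\triangleright f))(b\triangleleft f)$ for all $a,b\in G$, $f,f'\in F$. (For $G=\mathbb{Z}_2$ the action $\triangleleft$ is necessarily trivial.) The maps $\sigma:G\times F\times F\to\Bbbk^\times$ and $\tau:G\times G\times F\to\Bbbk^\times$ satisfy, for all $a,b,c\in G$, $f,f',f''\in F$: $\sigma(a;1_F,f)=\sigma(a;f,1_F)=\sigma(1_G;f,f')=1$; $\sigma(a\triangleleft f;f',f'')\sigma(a;f,f'f'')=\sigma(a;f,f')\sigma(a;ff',f'')$; $\tau(1_G,a;f)=\tau(a,1_G;f)=\tau(a,b;1_F)=1$; $\tau(a,b;c\triangleright f)\tau(ab,c;f)=\tau(a,bc;f)\tau(b,c;f)$; $\sigma(ab;f,f')\tau(a,b;ff')=\sigma(a;b\triangleright f,(b\triangleleft f)\triangleright f')\,\sigma(b;f,f')\,\tau(a,b;f)\,\tau(a\triangleleft(b\triangleright f),b\triangleleft f;f')$. The Hopf algebra $\Bbbk^G{}^\tau\#_{\sigma}\Bbbk F$ is the vector space $\Bbbk^G\otimes\Bbbk F$ with basis $p_a\# f:=p_a\otimes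 f$ ($a\in G,f\in F$; $\{p_a\}$ is the basis of $\Bbbk^G$ dual to $G\subset\Bbbk G$), multiplication $(p_a\# f)(p_{b}\# f')=\delta_{a\triangleleft f,b}\sigma(a;f,f')\,p_a\# ff'$, comultiplication $\Delta(p_a\# f)=\sum_{x\in G}\tau(ax^{-1},x;f)\,(p_{ax^{-1}}\#(x\triangleright f))\otimes(p_x\# f)$, unit $\sum_{a\in G}p_a\#1_F$ and counit $\varepsilon(p_a\# f)=\delta_{a,1_G}$. A coquasitriangular Hopf algebra $(H,R)$ is a Hopf algebra $H$ with a convolution-invertible bilinear form $R:H\otimes H\to\Bbbk$ such that $R(a,bc)=\sum R(a_{(1)},c)R(a_{(2)},b)$, $R(ab,c)=\sum R(a,c_{(1)})R(b,c_{(2)})$ and $\sum R(a_{(1)},b_{(1)})a_{(2)}b_{(2)}=\sum b_{(1)}a_{(1)}R(a_{(2)},b_{(2)})$ for all $a,b,c\in H$. $S=\{f\in F\mid g\triangleright f=f\}$ and $T=\{f\in F\mid g\triangleright f\neq f\}$. *)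

theory Defs
  imports "HOL-Computational_Algebra.Polynomial" "HOL-Library.Poly_Mapping"
begin

text \<open>
  A vector space with a basis indexed by the type \<open>'b\<close> is represented by the finitely supported
  functions \<open>'b \<Rightarrow>\<^sub>0 'k\<close>; the tensor product of the spaces with bases \<open>'b\<close> and \<open>'c\<close> is then
  the space with basis \<open>'b \<times> 'c\<close>. The ring multiplication that \<open>Poly_Mapping\<close>
  defines on this type is not used.
\<close>

definition scale :: "'k::field \<Rightarrow> ('b \<Rightarrow>\<^sub>0 'k) \<Rightarrow> ('b \<Rightarrow>\<^sub>0 'k)" where
  "scale c x = Poly_Mapping.map ((*) c) x"

abbreviation basis_vec :: "'b \<Rightarrow> ('b \<Rightarrow>\<^sub>0 'k::field)" where
  "basis_vec b \<equiv> Poly_Mapping.single b 1"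

text \<open>The linear extension of a map \<open>u\<close> given on the basis, into a space with scalar
  multiplication \<open>s\<close>.\<close>

definition linear_ext ::
    "('k::field \<Rightarrow> 'v::comm_monoid_add \<Rightarrow> 'v) \<Rightarrow> ('b \<Rightarrow> 'v) \<Rightarrow> ('b \<Rightarrow>\<^sub>0 'k) \<Rightarrow> 'v" where
  "linear_ext s u x = (\<Sum>b\<in>Poly_Mapping.keys x. s (Poly_Mapping.lookup x b) (u b))"

definition tensor :: "('b \<Rightarrow>\<^sub>0 'k::field) \<Rightarrow> ('c \<Rightarrow>\<^sub>0 'k) \<Rightarrow> ('b \<times> 'c \<Rightarrow>\<^sub>0 'k)" where
  "tensor x y = linear_ext scale (\<lambda>b. linear_ext scale (\<lambda>c. basis_vec (b, c)) y) x"

text \<open>The linear map on a tensor product induced by a bilinear map \<open>\<phi>\<close>. Sweedler's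
  \<open>\<Sum> \<phi>(x\<^sub>1, x\<^sub>2)\<close> is \<open>tensor_sum s \<phi> (\<Delta> x)\<close>.\<close>

definition tensor_sum ::
    "('k::field \<Rightarrow> 'v::comm_monoid_add \<Rightarrow> 'v) \<Rightarrow> (('b \<Rightarrow>\<^sub>0 'k) \<Rightarrow> ('c \<Rightarrow>\<^sub>0 'k) \<Rightarrow> 'v) \<Rightarrow>
      ('b \<times> 'c \<Rightarrow>\<^sub>0 'k) \<Rightarrow> 'v" where
  "tensor_sum s \<phi> = linear_ext s (\<lambda>(b, c). \<phi> (basis_vec b) (basis_vec c))"

definition tensor_assoc :: "(('b \<times> 'c) \<times> 'd \<Rightarrow>\<^sub>0 'k::field) \<Rightarrow> ('b \<times> 'c \<times> 'd \<Rightarrow>\<^sub>0 'k)" where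
  "tensor_assoc = linear_ext scale (\<lambda>((b, c), d). basis_vec (b, c, d))"

definition bilinear_map ::
    "('k::field \<Rightarrow> 'v::ab_group_add \<Rightarrow> 'v) \<Rightarrow> (('b \<Rightarrow>\<^sub>0 'k) \<Rightarrow> ('c \<Rightarrow>\<^sub>0 'k) \<Rightarrow> 'v) \<Rightarrow> bool" where
  "bilinear_map s \<phi> \<longleftrightarrow>
     (\<forall>x. Vector_Spaces.linear scale s (\<phi> x)) \<and>
     (\<forall>y. Vector_Spaces.linear scale s (\<lambda>x. \<phi> x y))"


locale hopf_algebra =
  fixes mult :: "('b \<Rightarrow>\<^sub>0 'k::field) \<Rightarrow> ('b \<Rightarrow>\<^sub>0 'k) \<Rightarrow> ('b \<Rightarrow>\<^sub>0 'k)"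
    and unit :: "'b \<Rightarrow>\<^sub>0 'k"
    and comult :: "('b \<Rightarrow>\<^sub>0 'k) \<Rightarrow> ('b \<times> 'b \<Rightarrow>\<^sub>0 'k)"
    and counit :: "('b \<Rightarrow>\<^sub>0 'k) \<Rightarrow> 'k"
  assumes mult_bilinear: "bilinear_map scale mult"
    and mult_assoc: "mult (mult x y) z = mult x (mult y z)"
    and mult_unit_left: "mult unit x = x"
    and mult_unit_right: "mult x unit = x"
    and comult_linear: "Vector_Spaces.linear scale scale comult"
    and counit_linear: "Vector_Spaces.linear scale (*) counit"
    and coassoc:
      "tensor_assoc (tensor_sum scale (\<lambda>x1 x2. tensor (comult x1) x2) (comult x)) =
       tensor_sum scale (\<lambda>x1 x2. tensor x1 (comult x2)) (comult x)"
    and counit_left: "tensor_sum scale (\<lambda>x1 x2. scale (counit x1) x2) (comult x) = x"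
    and counit_right: "tensor_sum scale (\<lambda>x1 x2. scale (counit x2) x1) (comult x) = x"
    and comult_mult:
      "comult (mult x y) =
       tensor_sum scale (\<lambda>x1 x2.
         tensor_sum scale (\<lambda>y1 y2. tensor (mult x1 y1) (mult x2 y2)) (comult y)) (comult x)"
    and comult_unit: "comult unit = tensor unit unit"
    and counit_mult: "counit (mult x y) = counit x * counit y"
    and counit_unit: "counit unit = 1"
    and antipode:
      "\<exists>A. Vector_Spaces.linear scale scale A \<and>
         (\<forall>x. tensor_sum scale (\<lambda>x1 x2. mult (A x1) x2) (comult x) = scale (counit x) unit) \<and>
         (\<forall>x. tensor_sum scale (\<lambda>x1 x2. mult x1 (A x2)) (comult x) = scale (counit x) unit)"

text \<open>The convolution product of bilinear forms.\<close>

definition convolution ::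
    "(('b \<Rightarrow>\<^sub>0 'k::field) \<Rightarrow> ('b \<times> 'b \<Rightarrow>\<^sub>0 'k)) \<Rightarrow>
     (('b \<Rightarrow>\<^sub>0 'k) \<Rightarrow> ('b \<Rightarrow>\<^sub>0 'k) \<Rightarrow> 'k) \<Rightarrow> (('b \<Rightarrow>\<^sub>0 'k) \<Rightarrow> ('b \<Rightarrow>\<^sub>0 'k) \<Rightarrow> 'k) \<Rightarrow>
     ('b \<Rightarrow>\<^sub>0 'k) \<Rightarrow> ('b \<Rightarrow>\<^sub>0 'k) \<Rightarrow> 'k" where
  "convolution comult P Q a b =
     tensor_sum (*) (\<lambda>a1 a2. tensor_sum (*) (\<lambda>b1 b2. P a1 b1 * Q a2 b2) (comult b)) (comult a)"

locale coquasitriangular_hopf_algebra = hopf_algebra +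
  fixes R :: "('b \<Rightarrow>\<^sub>0 'k::field) \<Rightarrow> ('b \<Rightarrow>\<^sub>0 'k) \<Rightarrow> 'k"
  assumes R_bilinear: "bilinear_map (*) R"
    and R_invertible:
      "\<exists>Q. bilinear_map (*) Q \<and>
         (\<forall>a b. convolution comult R Q a b = counit a * counit b) \<and>
         (\<forall>a b. convolution comult Q R a b = counit a * counit b)"
    and R_mult_right:
      "R a (mult b c) = tensor_sum (*) (\<lambda>a1 a2. R a1 c * R a2 b) (comult a)"
    and R_mult_left:
      "R (mult a b) c = tensor_sum (*) (\<lambda>c1 c2. R a c1 * R b c2) (comult c)"
    and R_commute:
      "tensor_sum scale (\<lambda>a1 a2.
         tensor_sum scale (\<lambda>b1 b2. scale (R a1 b1) (mult a2 b2)) (comult b)) (comult a) =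
       tensor_sum scale (\<lambda>a1 a2.
         tensor_sum scale (\<lambda>b1 b2. scale (R a2 b2) (mult b1 a1)) (comult b)) (comult a)"


text \<open>Groups, also non-abelian ones, are written additively: \<open>0\<close> is the identity of \<open>G\<close> and
  of \<open>F\<close>, and \<open>a x\<^sup>-\<^sup>1\<close> becomes \<open>a - x\<close>.\<close>

locale matched_pair =
  fixes right_act :: "'g::group_add \<Rightarrow> 'f::group_add \<Rightarrow> 'g" (infixl "\<triangleleft>" 70)
    and left_act :: "'g \<Rightarrow> 'f \<Rightarrow> 'f" (infixr "\<triangleright>" 70)
  assumes right_act_one: "a \<triangleleft> 0 = a"
    and right_act_act: "a \<triangleleft> (f + f') = (a \<triangleleft> f) \<triangleleft> f'"
    and left_act_one: "0 \<triangleright> f = f"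
    and left_act_act: "(a + b) \<triangleright> f = a \<triangleright> (b \<triangleright> f)"
    and left_act_mult: "a \<triangleright> (f + f') = (a \<triangleright> f) + ((a \<triangleleft> f) \<triangleright> f')"
    and right_act_mult: "(a + b) \<triangleleft> f = (a \<triangleleft> (b \<triangleright> f)) + (b \<triangleleft> f)"

locale cocycle_matched_pair = matched_pair right_act left_act
  for right_act :: "'g::group_add \<Rightarrow> 'f::group_add \<Rightarrow> 'g" (infixl "\<triangleleft>" 70)
    and left_act :: "'g \<Rightarrow> 'f \<Rightarrow> 'f" (infixr "\<triangleright>" 70) +
  fixes \<sigma> :: "'g \<Rightarrow> 'f \<Rightarrow> 'f \<Rightarrow> 'k::field"
    and \<tau> :: "'g \<Rightarrow> 'g \<Rightarrow> 'f \<Rightarrow> 'k"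
  assumes \<sigma>_nonzero: "\<sigma> a f f' \<noteq> 0"
    and \<tau>_nonzero: "\<tau> a b f \<noteq> 0"
    and \<sigma>_normal: "\<sigma> a 0 f = 1" "\<sigma> a f 0 = 1" "\<sigma> 0 f f' = 1"
    and \<sigma>_cocycle: "\<sigma> (a \<triangleleft> f) f' f'' * \<sigma> a f (f' + f'') = \<sigma> a f f' * \<sigma> a (f + f') f''"
    and \<tau>_normal: "\<tau> 0 a f = 1" "\<tau> a 0 f = 1" "\<tau> a b 0 = 1"
    and \<tau>_cocycle: "\<tau> a b (c \<triangleright> f) * \<tau> (a + b) c f = \<tau> a (b + c) f * \<tau> b c f"
    and \<sigma>_\<tau>_compatible:
      "\<sigma> (a + b) f f' * \<tau> a b (f + f') =
       \<sigma> a (b \<triangleright> f) ((b \<triangleleft> f) \<triangleright> f') * \<sigma> b f f' *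
       \<tau> a b f * \<tau> (a \<triangleleft> (b \<triangleright> f)) (b \<triangleleft> f) f'"

text \<open>The structure maps of the Hopf algebra \<open>k\<^sup>G \<^sup>\<tau>#\<^sub>\<sigma> k F\<close>, whose basis vector
  \<open>p\<^sub>a # f\<close> is \<open>bv a f\<close>.\<close>

abbreviation bv :: "'g \<Rightarrow> 'f \<Rightarrow> ('g \<times> 'f \<Rightarrow>\<^sub>0 'k::field)" where
  "bv a f \<equiv> basis_vec (a, f)"

definition bicrossed_mult ::
    "('g \<Rightarrow> 'f::group_add \<Rightarrow> 'g) \<Rightarrow> ('g \<Rightarrow> 'f \<Rightarrow> 'f \<Rightarrow> 'k::field) \<Rightarrow>
     ('g \<times> 'f \<Rightarrow>\<^sub>0 'k) \<Rightarrow> ('g \<times> 'f \<Rightarrow>\<^sub>0 'k) \<Rightarrow> ('g \<times> 'f \<Rightarrow>\<^sub>0 'k)" where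
  "bicrossed_mult right_act \<sigma> x y =
     linear_ext scale (\<lambda>(a, f). linear_ext scale (\<lambda>(b, f').
       if right_act a f = b then scale (\<sigma> a f f') (bv a (f + f')) else 0) y) x"

definition bicrossed_unit :: "'g::finite \<times> 'f::group_add \<Rightarrow>\<^sub>0 'k::field" where
  "bicrossed_unit = (\<Sum>a\<in>UNIV. bv a 0)"

definition bicrossed_comult ::
    "('g::{group_add, finite} \<Rightarrow> 'f \<Rightarrow> 'f) \<Rightarrow> ('g \<Rightarrow> 'g \<Rightarrow> 'f \<Rightarrow> 'k::field) \<Rightarrow>
     ('g \<times> 'f \<Rightarrow>\<^sub>0 'k) \<Rightarrow> (('g \<times> 'f) \<times> ('g \<times> 'f) \<Rightarrow>\<^sub>0 'k)" where
  "bicrossed_comult left_act \<tau> =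
     linear_ext scale (\<lambda>(a, f).
       \<Sum>x\<in>UNIV. scale (\<tau> (a - x) x f) (tensor (bv (a - x) (left_act x f)) (bv x f)))"

definition bicrossed_counit :: "('g::group_add \<times> 'f \<Rightarrow>\<^sub>0 'k::field) \<Rightarrow> 'k" where
  "bicrossed_counit = linear_ext (*) (\<lambda>(a, f). if a = 0 then 1 else 0)"

definition fixed_elems :: "('g \<Rightarrow> 'f \<Rightarrow> 'f) \<Rightarrow> 'g \<Rightarrow> 'f set" where
  "fixed_elems left_act g = {f. left_act g f = f}"

definition moved_elems :: "('g \<Rightarrow> 'f \<Rightarrow> 'f) \<Rightarrow> 'g \<Rightarrow> 'f set" where
  "moved_elems left_act g = {f. left_act g f \<noteq> f}"

end

theory Submission
  imports Defs
begin

text \<open>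
  Write \<open>E\<^sub>f = p\<^sub>1 # f\<close> and \<open>X\<^sub>f = p\<^sub>g # f\<close>, and \<open>f'\<close> for \<open>g \<triangleright> f\<close>. The right action of \<open>F\<close> on
  a group of order two is trivial, so \<open>f \<mapsto> f'\<close> is an involutive automorphism of \<open>F\<close> and
  the algebra is the direct product of the span of the \<open>E\<^sub>f\<close> and the span of the \<open>X\<^sub>f\<close>, while
  \<open>\<Delta> E\<^sub>f = E\<^sub>f \<otimes> E\<^sub>f + \<tau>(f) X\<^sub>f\<^sub>' \<otimes> X\<^sub>f\<close> and \<open>\<Delta> X\<^sub>f = X\<^sub>f \<otimes> E\<^sub>f + E\<^sub>f\<^sub>' \<otimes> X\<^sub>f\<close>. The form \<open>R\<close> thus
  amounts to four scalar functions on \<open>F \<times> F\<close>,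
  \<open>A(f,h) = R(E\<^sub>f,E\<^sub>h)\<close>, \<open>B(f,h) = R(E\<^sub>f,X\<^sub>h)\<close>, \<open>C(f,h) = R(X\<^sub>f,E\<^sub>h)\<close>, \<open>D(f,h) = R(X\<^sub>f,X\<^sub>h)\<close>, and
  each axiom becomes a polynomial identity between them.

  Three kinds of identity are used.
  Comparing coefficients in the commutation axiom, where commutativity of \<open>F\<close> enters, gives the
  supports: \<open>B(f,h) \<noteq> 0\<close> forces \<open>h \<in> S\<close>, \<open>C(f,h) \<noteq> 0\<close> forces \<open>f \<in> S\<close>, and \<open>D(f,h) \<noteq> 0\<close> forces
  \<open>f + h \<in> S\<close>, so that \<open>f\<close> and \<open>h\<close> lie both in \<open>S\<close> or both in \<open>T\<close>.
  The multiplicativity axioms give product formulas and, because \<open>E\<^sub>f X\<^sub>h = 0\<close>, vanishing relations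
  between products of two values.
  Convolution invertibility gives \<open>R(-,1) = \<epsilon> = R(1,-)\<close>; since \<open>1 = E\<^sub>0 + X\<^sub>0\<close>, this reads
  \<open>A(f,0) + B(f,0) = 1 = A(0,h) + C(0,h)\<close> on the \<open>E\<close>-vectors.

  Two cases arise, according to the values of \<open>A\<close> on \<open>T \<times> F\<close>. If \<open>A(t,k) \<noteq> 0\<close> for some \<open>t \<in> T\<close> and
  some \<open>k\<close>, the vanishing relations kill \<open>B\<close>, \<open>C\<close> and \<open>D\<close> in the row of \<open>t\<close>. The product formula for
  \<open>0 = t + (-t)\<close> then shows that \<open>A(t,-)\<close> has no zero, and further vanishing relations
  spread \<open>B = C = D = 0\<close> to all rows (\<open>mixed_values_vanish\<close>). If on the contrary \<open>A\<close> vanishes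
  on \<open>T \<times> F\<close>, the normalisation shows that \<open>B(t,h)\<close> for \<open>h \<in> S\<close> and \<open>C(s,h)\<close> for \<open>s \<in> S\<close>, \<open>h \<in> T\<close>
  are nonzero. Multiplying by these values removes whatever the supports have left of the values
  of \<open>B\<close>, \<open>C\<close>, \<open>D\<close> that the second alternative excludes, and \<open>A(0,h) = 0\<close> for \<open>h \<in> T\<close> does the same
  for \<open>A\<close> (\<open>values_supported_by_parity\<close>).
\<close>

section \<open>Linear extensions of finitely supported functions\<close>

lemma linear_ext_add:
  fixes s :: "'k::field \<Rightarrow> 'v::comm_monoid_add \<Rightarrow> 'v"
  assumes s0: "\<And>v. s 0 v = 0" and s_add: "\<And>c d v. s (c + d) v = s c v + s d v"
  shows "linear_ext s u (x + y) = linear_ext s u x + linear_ext s u y"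
proof -
  have *: "linear_ext s u z = (\<Sum>b\<in>K. s (Poly_Mapping.lookup z b) (u b))"
    if "Poly_Mapping.keys z \<subseteq> K" "finite K" for z K
    unfolding linear_ext_def
    by (rule sum.mono_neutral_left) (use that in \<open>auto simp: s0 in_keys_iff\<close>)
  let ?K = "Poly_Mapping.keys x \<union> Poly_Mapping.keys y"
  show ?thesis
    using Poly_Mapping.keys_add[of x y]
    by (simp add: *[of _ ?K] lookup_add s_add sum.distrib)
qed

lemma linear_ext_single:
  assumes "\<And>v. s 0 v = 0"
  shows "linear_ext s u (Poly_Mapping.single b c) = s c (u b)"
  using assms by (cases "c = 0") (simp_all add: linear_ext_def)

lemma lookup_scale [simp]: "Poly_Mapping.lookup (scale c x) b = c * Poly_Mapping.lookup x b"
  unfolding scale_def by (simp add: Poly_Mapping.map.rep_eq when_def)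

lemma scale_simps [simp]:
  "scale 0 x = 0" "scale c 0 = 0" "scale 1 x = x"
  "scale c (Poly_Mapping.single b d) = Poly_Mapping.single b (c * d)"
  by (rule poly_mapping_eqI, simp add: lookup_single when_def)+

lemma scale_add_left: "scale (c + d) x = scale c x + scale d x"
  by (rule poly_mapping_eqI) (simp add: lookup_add algebra_simps)

lemma tensor_basis_vec [simp]: "tensor (basis_vec b) (basis_vec c) = basis_vec (b, c)"
  by (simp add: tensor_def linear_ext_single)

lemma tensor_sum_scale:
  "tensor_sum scale \<phi> (Poly_Mapping.single (b, c) r + Poly_Mapping.single (b', c') r') =
     scale r (\<phi> (basis_vec b) (basis_vec c)) + scale r' (\<phi> (basis_vec b') (basis_vec c'))"
  by (simp add: tensor_sum_def linear_ext_add linear_ext_single scale_add_left)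

lemma tensor_sum_field:
  "tensor_sum (*) \<phi> (Poly_Mapping.single (b, c) r + Poly_Mapping.single (b', c') r') =
     r * \<phi> (basis_vec b) (basis_vec c) + r' * \<phi> (basis_vec b') (basis_vec c')"
  by (simp add: tensor_sum_def linear_ext_add linear_ext_single algebra_simps)

lemma bilinear_map_field:
  assumes "bilinear_map (*) \<phi>"
  shows "\<phi> (x + y) z = \<phi> x z + \<phi> y z" "\<phi> x (y + z) = \<phi> x y + \<phi> x z"
    and "\<phi> (scale c x) z = c * \<phi> x z" "\<phi> x (scale c z) = c * \<phi> x z"
    and "\<phi> 0 z = 0" "\<phi> x 0 = 0"
proof -
  have l: "Vector_Spaces.linear scale (*) (\<phi> x)" "Vector_Spaces.linear scale (*) (\<lambda>x. \<phi> x z)"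
    for x z using assms by (auto simp: bilinear_map_def)
  show "\<phi> (x + y) z = \<phi> x z + \<phi> y z" "\<phi> x (y + z) = \<phi> x y + \<phi> x z"
    using l[THEN Vector_Spaces.linear.axioms(3), THEN module_hom.add] by auto
  show scale: "\<phi> (scale c x) z = c * \<phi> x z" "\<phi> x (scale c z) = c * \<phi> x z" for c x z
    using l[THEN Vector_Spaces.linear.axioms(3), THEN module_hom.scale] by auto
  show "\<phi> 0 z = 0" "\<phi> x 0 = 0" using scale[where c = 0] by simp_all
qed

section \<open>The Hopf algebra for a group of order two\<close>

locale coquasitriangular_Z2_extension =
  cocycle_matched_pair right_act left_act \<sigma> \<tau> +
  coquasitriangular_hopf_algebra
    "bicrossed_mult right_act \<sigma>" bicrossed_unit "bicrossed_comult left_act \<tau>" bicrossed_counit R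
  for right_act :: "'g::{group_add, finite} \<Rightarrow> 'f::ab_group_add \<Rightarrow> 'g" (infixl "\<triangleleft>" 70)
    and left_act :: "'g \<Rightarrow> 'f \<Rightarrow> 'f" (infixr "\<triangleright>" 70)
    and \<sigma> :: "'g \<Rightarrow> 'f \<Rightarrow> 'f \<Rightarrow> 'k::field"
    and \<tau> :: "'g \<Rightarrow> 'g \<Rightarrow> 'f \<Rightarrow> 'k"
    and R :: "('g \<times> 'f \<Rightarrow>\<^sub>0 'k) \<Rightarrow> ('g \<times> 'f \<Rightarrow>\<^sub>0 'k) \<Rightarrow> 'k" +
  fixes g :: 'g
  assumes UNIV_Z2: "(UNIV :: 'g set) = {0, g}" and g_nonzero: "g \<noteq> 0"
begin

lemma g_plus_g: "g + g = 0"
proof -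
  have "g + g \<in> {0, g}" using UNIV_Z2 by blast
  then show ?thesis using g_nonzero by (metis add.right_neutral add_left_cancel empty_iff insert_iff)
qed

lemma minus_g: "- g = g"
  using g_plus_g by (rule minus_unique)

text \<open>The action fixes \<open>0\<close> because \<open>0 + 0 = 0\<close>, and it acts by permutations of \<open>{0, g}\<close>.\<close>

lemma right_act_trivial [simp]: "a \<triangleleft> f = a"
proof -
  have zero: "0 \<triangleleft> f = 0" for f
    using right_act_mult[of 0 0 f] add_left_cancel[of "0 \<triangleleft> f" "0 \<triangleleft> f" 0]
    by (simp add: left_act_one)
  have "g \<triangleleft> f \<noteq> 0"
  proof
    assume "g \<triangleleft> f = 0"
    then have "g \<triangleleft> (f + - f) = 0" by (simp only: right_act_act zero)
    then show False using g_nonzero by (simp add: right_act_one)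
  qed
  moreover have "g \<triangleleft> f \<in> {0, g}" "a \<in> {0, g}" using UNIV_Z2 by blast+
  ultimately show ?thesis using zero by auto
qed

lemma left_act_add: "a \<triangleright> (f + h) = a \<triangleright> f + a \<triangleright> h"
  by (simp add: left_act_mult)

lemma left_act_involution [simp]: "g \<triangleright> g \<triangleright> f = f"
  by (metis g_plus_g left_act_act left_act_one)

abbreviation "E f \<equiv> bv (0::'g) (f::'f) :: 'g \<times> 'f \<Rightarrow>\<^sub>0 'k"
abbreviation "X f \<equiv> bv g (f::'f) :: 'g \<times> 'f \<Rightarrow>\<^sub>0 'k"

lemma mult_simps:
  "bicrossed_mult right_act \<sigma> (E f) (E h) = E (f + h)"
  "bicrossed_mult right_act \<sigma> (X f) (X h) = scale (\<sigma> g f h) (X (f + h))"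
  "bicrossed_mult right_act \<sigma> (E f) (X h) = 0"
  "bicrossed_mult right_act \<sigma> (X f) (E h) = 0"
  using g_nonzero by (simp_all add: bicrossed_mult_def linear_ext_single \<sigma>_normal)

lemma comult_E:
  "bicrossed_comult left_act \<tau> (E f) =
     Poly_Mapping.single ((0, f), (0, f)) 1 + Poly_Mapping.single ((g, g \<triangleright> f), (g, f)) (\<tau> g g f)"
  using g_nonzero
  by (simp add: bicrossed_comult_def linear_ext_single UNIV_Z2 \<tau>_normal left_act_one minus_g)

lemma comult_X:
  "bicrossed_comult left_act \<tau> (X f) =
     Poly_Mapping.single ((g, f), (0, f)) 1 + Poly_Mapping.single ((0, g \<triangleright> f), (g, f)) 1"
  using g_nonzero
  by (simp add: bicrossed_comult_def linear_ext_single UNIV_Z2 \<tau>_normal left_act_one)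

lemma unit_eq: "bicrossed_unit = E 0 + X 0"
  using g_nonzero by (simp add: bicrossed_unit_def UNIV_Z2)

lemma counit_simps: "bicrossed_counit (E f) = (1::'k)" "bicrossed_counit (X f) = (0::'k)"
  using g_nonzero by (simp_all add: bicrossed_counit_def linear_ext_single)

lemmas sweedler = comult_E comult_X tensor_sum_field tensor_sum_scale

section \<open>The axioms of the form in coordinates\<close>

abbreviation "A f h \<equiv> R (E f) (E h)"
abbreviation "B f h \<equiv> R (E f) (X h)"
abbreviation "C f h \<equiv> R (X f) (E h)"
abbreviation "D f h \<equiv> R (X f) (X h)"

lemmas R_lin = bilinear_map_field[OF R_bilinear]

text \<open>Multiplicativity in the second argument. The relations with left-hand side \<open>0\<close> come from
  \<open>E\<^sub>h X\<^sub>k = X\<^sub>h E\<^sub>k = 0\<close>.\<close>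

lemma R_row:
  "0 = B f k * A f h + \<tau> g g f * D (g \<triangleright> f) k * C f h"
  "0 = A f k * B f h + \<tau> g g f * C (g \<triangleright> f) k * D f h"
  "\<sigma> g h k * B f (h + k) = B f k * B f h + \<tau> g g f * D (g \<triangleright> f) k * D f h"
  "0 = D f k * A f h + B (g \<triangleright> f) k * C f h"
  using R_mult_right[of "E f" "E h" "X k"] R_mult_right[of "E f" "X h" "E k"]
    R_mult_right[of "E f" "X h" "X k"] R_mult_right[of "X f" "E h" "X k"]
  by (simp_all only: mult_simps sweedler R_lin) (simp_all add: mult.assoc)

text \<open>Multiplicativity in the first argument.\<close>

lemma R_column:
  "A (f + k) h = A f h * A k h + \<tau> g g h * B f (g \<triangleright> h) * B k h"
  "0 = A f h * C k h + \<tau> g g h * B f (g \<triangleright> h) * D k h"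
  "\<sigma> g f k * C (f + k) h = C f h * C k h + \<tau> g g h * D f (g \<triangleright> h) * D k h"
  "0 = B f h * C k h + A f (g \<triangleright> h) * D k h"
  using R_mult_left[of "E f" "E k" "E h"] R_mult_left[of "E f" "X k" "E h"]
    R_mult_left[of "X f" "X k" "E h"] R_mult_left[of "E f" "X k" "X h"]
  by (simp_all only: mult_simps sweedler R_lin) (simp_all add: mult.assoc)

text \<open>In the commutation axiom for \<open>E\<^sub>f, X\<^sub>h\<close>, the value \<open>B(f,h)\<close> is the coefficient of \<open>E\<close> at
  \<open>f + h\<close> on one side and at \<open>f + h'\<close> on the other, so it vanishes unless \<open>h = h'\<close>. On the
  \<open>X\<close>-vectors, a nonzero multiple of \<open>C(f,h)\<close> sits at \<open>h + f'\<close> on the right, while the left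
  has support in \<open>f + h\<close>. For \<open>X\<^sub>f, X\<^sub>h\<close>, the value \<open>D(f,h)\<close> is the coefficient of \<open>E\<close> at \<open>f + h\<close>
  and at \<open>f' + h'\<close>.\<close>

lemma support_B: "B f h \<noteq> 0 \<Longrightarrow> g \<triangleright> h = h"
  and support_C: "C f h \<noteq> 0 \<Longrightarrow> g \<triangleright> f = f"
proof -
  have eq: "scale (B f h) (E (f + h))
        + scale (\<tau> g g f * C (g \<triangleright> f) (g \<triangleright> h) * \<sigma> g f h) (X (f + h))
      = scale (B f h) (E (f + g \<triangleright> h))
        + scale (\<tau> g g f * C f h * \<sigma> g h (g \<triangleright> f)) (X (h + g \<triangleright> f))"
    using R_commute[where a = "E f" and b = "X h"]
    by (simp add: mult_simps sweedler add_ac mult_ac)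
  show "g \<triangleright> h = h" if "B f h \<noteq> 0"
    using arg_cong[OF eq, of "\<lambda>x. Poly_Mapping.lookup x (0, f + h)"] g_nonzero that
    by (auto simp: lookup_add lookup_single when_def split: if_splits)
  show "g \<triangleright> f = f" if "C f h \<noteq> 0"
  proof (rule ccontr)
    assume "g \<triangleright> f \<noteq> f"
    then have "f + h \<noteq> h + g \<triangleright> f" by (metis add.commute add_left_cancel)
    then have "\<tau> g g f * C f h * \<sigma> g h (g \<triangleright> f) = 0"
      using arg_cong[OF eq, of "\<lambda>x. Poly_Mapping.lookup x (g, h + g \<triangleright> f)"] g_nonzero
      by (simp add: lookup_add lookup_single)
    then show False using that \<sigma>_nonzero \<tau>_nonzero by simp
  qed
qed

lemma support_D:
  assumes "D f h \<noteq> 0"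
  shows "g \<triangleright> f = f \<longleftrightarrow> g \<triangleright> h = h"
proof -
  have "Poly_Mapping.single (0, f + h) (D f h)
        + Poly_Mapping.single (g, f + h) (A (g \<triangleright> f) (g \<triangleright> h) * \<sigma> g f h)
      = Poly_Mapping.single (0, g \<triangleright> f + g \<triangleright> h) (D f h)
        + Poly_Mapping.single (g, f + h) (A f h * \<sigma> g h f)"
    using R_commute[where a = "X f" and b = "X h"]
    by (simp add: mult_simps sweedler add_ac mult_ac)
  from arg_cong[OF this, of "\<lambda>x. Poly_Mapping.lookup x (0, f + h)"]
  have "g \<triangleright> f + g \<triangleright> h = f + h"
    using g_nonzero assms by (auto simp: lookup_add lookup_single when_def split: if_splits)
  then show ?thesis by (metis add_left_cancel add_right_cancel)
qed

text \<open>A convolution-idempotent functional \<open>u\<close> with convolution inverse \<open>q\<close> is the counit: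
  \<open>u = u * (u * q) = (u * u) * q = u * q\<close>. The calculation below writes this out at \<open>E\<^sub>f\<close>.\<close>

lemma idempotent_functional_at_E:
  assumes idem: "\<And>a. u a = tensor_sum (*) (\<lambda>a1 a2. u a1 * u a2) (bicrossed_comult left_act \<tau> a)"
    and inverse: "\<And>a. tensor_sum (*) (\<lambda>a1 a2. u a1 * q a2) (bicrossed_comult left_act \<tau> a) =
                       bicrossed_counit a"
  shows "u (E f) = (1::'k)"
proof -
  let ?f' = "g \<triangleright> f" and ?t = "\<tau> g g f"
  have uE: "u (E f) = u (E f) * u (E f) + ?t * (u (X ?f') * u (X f))"
    using idem[of "E f"] by (simp add: sweedler)
  have uX: "u (X ?f') = u (X ?f') * u (E ?f') + u (E f) * u (X ?f')"
    using idem[of "X ?f'"] by (simp add: sweedler)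
  have qE: "u (E f) * q (E f) + ?t * (u (X ?f') * q (X f)) = 1"
    using inverse[of "E f"] by (simp add: sweedler counit_simps)
  have qX: "u (X f) * q (E f) + u (E ?f') * q (X f) = 0"
    using inverse[of "X f"] by (simp add: sweedler counit_simps)
  have "1 = (u (E f) * u (E f) + ?t * (u (X ?f') * u (X f))) * q (E f)
            + ?t * ((u (X ?f') * u (E ?f') + u (E f) * u (X ?f')) * q (X f))"
    using qE uE uX by simp
  also have "\<dots> = u (E f) * (u (E f) * q (E f) + ?t * (u (X ?f') * q (X f)))
            + ?t * u (X ?f') * (u (X f) * q (E f) + u (E ?f') * q (X f))"
    by (simp add: algebra_simps)
  also have "\<dots> = u (E f)" by (simp add: qE qX)
  finally show ?thesis by simp
qed

lemma tensor_sum_comult_unit: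
  assumes "\<And>x y z. \<phi> (x + y) z = \<phi> x z + \<phi> y z" "\<And>x y z. \<phi> x (y + z) = \<phi> x y + \<phi> x z"
  shows "tensor_sum (*) \<phi> (bicrossed_comult left_act \<tau> bicrossed_unit) =
         (\<phi> bicrossed_unit bicrossed_unit :: 'k)"
  unfolding comult_unit
  by (simp add: tensor_def tensor_sum_def unit_eq linear_ext_add linear_ext_single
      scale_add_left distrib_right assms)

text \<open>The functionals \<open>R(-,1)\<close> and \<open>R(1,-)\<close> are idempotent because \<open>1 \<cdot> 1 = 1\<close>, and they are
  invertible because \<open>\<Delta> 1 = 1 \<otimes> 1\<close> turns the inverse of \<open>R\<close> into inverses of them.\<close>

lemma R_unit:
  shows R_unit_right: "A f 0 + B f 0 = 1"
    and R_unit_left: "A 0 h + C 0 h = 1"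
proof -
  obtain Q where Q: "bilinear_map (*) Q" and
    inv: "\<And>a b. convolution (bicrossed_comult left_act \<tau>) R Q a b =
                bicrossed_counit a * bicrossed_counit b"
    using R_invertible by blast
  note Q_lin = bilinear_map_field[OF Q]
  let ?u = "bicrossed_unit :: 'g \<times> 'f \<Rightarrow>\<^sub>0 'k"
  have "R (E f) ?u = 1"
  proof (rule idempotent_functional_at_E)
    show "R a ?u = tensor_sum (*) (\<lambda>a1 a2. R a1 ?u * R a2 ?u) (bicrossed_comult left_act \<tau> a)" for a
      using R_mult_right[of a ?u ?u] by (simp add: mult_unit_left)
    show "tensor_sum (*) (\<lambda>a1 a2. R a1 ?u * Q a2 ?u) (bicrossed_comult left_act \<tau> a) =
          bicrossed_counit a" for a
      using inv[of a ?u]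
      by (simp add: convolution_def tensor_sum_comult_unit R_lin Q_lin algebra_simps counit_unit)
  qed
  then show "A f 0 + B f 0 = 1" by (simp add: unit_eq R_lin)
  have "R ?u (E h) = 1"
  proof (rule idempotent_functional_at_E[where u = "R ?u"])
    show "R ?u a = tensor_sum (*) (\<lambda>a1 a2. R ?u a1 * R ?u a2) (bicrossed_comult left_act \<tau> a)" for a
      using R_mult_left[of ?u ?u a] by (simp add: mult_unit_left)
    have additive: "tensor_sum (*) (\<lambda>b1 b2. P b1 b2 + P' b1 b2) z =
        tensor_sum (*) P z + (tensor_sum (*) P' z :: 'k)"
      for P P' :: "('g \<times> 'f \<Rightarrow>\<^sub>0 'k) \<Rightarrow> ('g \<times> 'f \<Rightarrow>\<^sub>0 'k) \<Rightarrow> 'k" and z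
      by (simp add: tensor_sum_def linear_ext_def case_prod_unfold sum.distrib distrib_left)
    show "tensor_sum (*) (\<lambda>a1 a2. R ?u a1 * Q ?u a2) (bicrossed_comult left_act \<tau> a) =
          bicrossed_counit a" for a
      using inv[of ?u a]
      by (simp add: convolution_def tensor_sum_comult_unit R_lin Q_lin additive
          distrib_left distrib_right counit_unit)
  qed
  then show "A 0 h + C 0 h = 1" by (simp add: unit_eq R_lin)
qed

section \<open>The two alternatives\<close>

text \<open>The row of \<open>t\<close> reduces to the nowhere vanishing function \<open>A(t,-)\<close>, as \<open>t\<close> and \<open>-t\<close> have
  product \<open>0\<close> in the first argument and \<open>A(0,h) = 1\<close>. As a factor it then kills \<open>C\<close> and \<open>D\<close> in
  every row. With these gone, \<open>A(f,h)B(f,k) = 0\<close> for all \<open>k\<close>, and it suffices to find an \<open>h\<close> with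
  \<open>A(f,h) \<noteq> 0\<close>; any moved \<open>h\<close> will do, because \<open>B(-,h) = 0\<close> for it and so
  \<open>A(f,h)A(-f,h) = A(0,h) = 1\<close>.\<close>

lemma mixed_values_vanish:
  assumes t: "g \<triangleright> t \<noteq> t" and k: "A t k \<noteq> 0"
  shows "B f h = 0 \<and> C f h = 0 \<and> D f h = 0"
proof -
  have t': "g \<triangleright> g \<triangleright> t \<noteq> g \<triangleright> t" using t by auto
  have Ct: "C t h = 0" "C (g \<triangleright> t) h = 0" for h
    using support_C t t' by blast+
  have Bt: "B t h = 0" for h using R_row(2)[of t k h] k Ct by simp
  have Dt: "D t h = 0" for h using R_row(4)[of t h k] k Ct by simp
  have C0: "C 0 h = 0" for h
    using R_column(3)[of t "- t" h] Ct Dt \<sigma>_nonzero by simp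
  have A0: "A 0 h = 1" for h using R_unit_left[of h] C0 by simp
  have At: "A t h \<noteq> 0" for h using R_column(1)[of t "- t" h] A0 Bt by auto
  have C: "C f h = 0" for f h using R_column(2)[of t h f] At Bt by auto
  have D: "D f h = 0" for f h using R_column(4)[of t h f] At Bt by auto
  have "A f t \<noteq> 0"
  proof -
    have "B f (g \<triangleright> t) = 0" using support_B t' by blast
    then show ?thesis using R_column(1)[of f "- f" t] A0 by auto
  qed
  then have "B f h = 0" using R_row(1)[of f h t] D by simp
  then show ?thesis using C D by blast
qed

text \<open>Here the nonzero multipliers are \<open>B(t,h)\<close> for \<open>t\<close> moved and \<open>h\<close> fixed, and \<open>C(s,h)\<close> for \<open>s\<close>
  fixed and \<open>h\<close> moved: by the product formula for \<open>h + (-h) = 0\<close> or \<open>s + (-s) = 0\<close> they divide a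
  nonzero multiple of \<open>B(t,0)\<close> or \<open>C(0,h)\<close>, which is \<open>1\<close> by the normalisation since \<open>A\<close> vanishes
  there.\<close>

lemma values_supported_by_parity:
  assumes t: "g \<triangleright> t \<noteq> t" and A_moved: "\<And>t k. g \<triangleright> t \<noteq> t \<Longrightarrow> A t k = 0"
  shows "A f h \<noteq> 0 \<Longrightarrow> g \<triangleright> f = f \<and> g \<triangleright> h = h"
    and "B f h \<noteq> 0 \<Longrightarrow> g \<triangleright> f \<noteq> f \<and> g \<triangleright> h = h"
    and "C f h \<noteq> 0 \<Longrightarrow> g \<triangleright> f = f \<and> g \<triangleright> h \<noteq> h"
    and "D f h \<noteq> 0 \<Longrightarrow> g \<triangleright> f \<noteq> f \<and> g \<triangleright> h \<noteq> h"
proof -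
  have moved': "g \<triangleright> g \<triangleright> h \<noteq> g \<triangleright> h" if "g \<triangleright> h \<noteq> h" for h
    using that by auto
  have B_moved: "B f h = 0" if "g \<triangleright> h \<noteq> h" for f h using support_B that by blast
  have A0: "A 0 h = 0" if "g \<triangleright> h \<noteq> h" for h
    using R_column(1)[of t "- t" h] B_moved moved' A_moved[OF t] that by simp
  have A: "A f h = 0" if "g \<triangleright> h \<noteq> h" for f h
    using R_column(1)[of f 0 h] A0 B_moved moved' that by simp
  have C: "C s h \<noteq> 0" if s: "g \<triangleright> s = s" and h: "g \<triangleright> h \<noteq> h" for s h
  proof -
    have "C 0 h = 1" using R_unit_left[of h] A0 h by simp
    moreover have "D s (g \<triangleright> h) = 0" using support_D s moved'[OF h] by blast
    ultimately show ?thesis using R_column(3)[of s "- s" h] \<sigma>_nonzero by auto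
  qed
  have B: "B t h \<noteq> 0" if h: "g \<triangleright> h = h" for h
  proof -
    have "B t 0 = 1" using R_unit_right[of t] A_moved[OF t] by simp
    moreover have "D t h = 0" using support_D t h by blast
    ultimately show ?thesis using R_row(3)[of h "- h" t] \<sigma>_nonzero by auto
  qed
  show "g \<triangleright> f = f \<and> g \<triangleright> h = h" if "A f h \<noteq> 0" using A A_moved that by blast
  have B_fixed: "B s k = 0" if s: "g \<triangleright> s = s" for s k
    using R_row(4)[of s k t] A t C[OF s t] s by simp
  show "g \<triangleright> f \<noteq> f \<and> g \<triangleright> h = h" if "B f h \<noteq> 0"
    using B_fixed support_B that by blast
  have "C k h = 0" if "g \<triangleright> h = h" for k
    using R_column(4)[of t h k] B[OF that] A_moved[OF t] by simp
  then show "g \<triangleright> f = f \<and> g \<triangleright> h \<noteq> h" if "C f h \<noteq> 0"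
    using support_C that by blast
  have "D s k = 0" if s: "g \<triangleright> s = s" for s k
    using R_row(2)[of s t k] A t C[OF s t] s \<tau>_nonzero by simp
  then show "g \<triangleright> f \<noteq> f \<and> g \<triangleright> h \<noteq> h" if "D f h \<noteq> 0"
    using support_D that by blast
qed

end

theorem proposition5p10:
  fixes g :: "'g::{group_add, finite}"
    and right_act :: "'g \<Rightarrow> 'f::ab_group_add \<Rightarrow> 'g"
    and left_act :: "'g \<Rightarrow> 'f \<Rightarrow> 'f"
    and \<sigma> :: "'g \<Rightarrow> 'f \<Rightarrow> 'f \<Rightarrow> 'k::{alg_closed_field, field_char_0}"
    and \<tau> :: "'g \<Rightarrow> 'g \<Rightarrow> 'f \<Rightarrow> 'k"
    and R :: "('g \<times> 'f \<Rightarrow>\<^sub>0 'k) \<Rightarrow> ('g \<times> 'f \<Rightarrow>\<^sub>0 'k) \<Rightarrow> 'k"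
    and S T :: "'f set"
  defines "S \<equiv> fixed_elems left_act g"
    and "T \<equiv> moved_elems left_act g"
  assumes G_is_Z2: "(UNIV :: 'g set) = {0, g}" "g \<noteq> 0"
    and cocycle_matched_pair: "cocycle_matched_pair right_act left_act \<sigma> \<tau>"
    and coquasitriangular:
      "coquasitriangular_hopf_algebra
         (bicrossed_mult right_act \<sigma>) bicrossed_unit
         (bicrossed_comult left_act \<tau>) bicrossed_counit R"
    and F_ne_S: "(UNIV :: 'f set) \<noteq> S"
  shows
    "(\<forall>f f'. R (bv 0 f) (bv g f') = 0 \<and> R (bv g f) (bv 0 f') = 0 \<and> R (bv g f) (bv g f') = 0)
     \<or>
     (\<forall>f f'.
        (R (bv 0 f) (bv 0 f') \<noteq> 0 \<longrightarrow> f \<in> S \<and> f' \<in> S) \<and>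
        (R (bv 0 f) (bv g f') \<noteq> 0 \<longrightarrow> f \<in> T \<and> f' \<in> S) \<and>
        (R (bv g f) (bv 0 f') \<noteq> 0 \<longrightarrow> f \<in> S \<and> f' \<in> T) \<and>
        (R (bv g f) (bv g f') \<noteq> 0 \<longrightarrow> f \<in> T \<and> f' \<in> T))"
proof -
  interpret coquasitriangular_Z2_extension right_act left_act \<sigma> \<tau> R g
    using cocycle_matched_pair coquasitriangular G_is_Z2
    by (simp add: coquasitriangular_Z2_extension_def coquasitriangular_Z2_extension_axioms_def)
  obtain t where t: "left_act g t \<noteq> t"
    using F_ne_S by (auto simp: S_def fixed_elems_def)
  show ?thesis
  proof (cases "\<exists>t k. left_act g t \<noteq> t \<and> R (bv 0 t) (bv 0 k) \<noteq> 0")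
    case True
    then show ?thesis using mixed_values_vanish by blast
  next
    case False
    then have "\<And>t k. left_act g t \<noteq> t \<Longrightarrow> R (bv 0 t) (bv 0 k) = 0" by blast
    from values_supported_by_parity[OF t this] show ?thesis
      unfolding S_def T_def fixed_elems_def moved_elems_def mem_Collect_eq by blast
  qed
qed

end
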